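(* Let $G=A\rtimes K$ with $A$ and $K$ finite abelian groups. With $C_B$ and $\lambda(B)$ as defined in the context for each $B\le K$, \[ m(G)=\max_{B\le K}|C_B|\,|B|, \qquad N_{\max}(G)=\sum_{\substack{B\le K\\ |C_B|\,|B|=m(G)}}\lambda(B). \] Equivalently, as $r\to\infty$, \[ |\mathrm{Hom}(\mathbb Z^r,G)|= \left(\sum_{\substack{B\le K\\ |C_B|\,|B|=m(G)}}\lambda(B)\right)m(G)^r+O\bigl(b(G)^r\bigr). \]
   Context: $A$ is the normal factor of $A\rtimes K$ and $\pi:G\to K$ is the natural projection. For $B\le K$, $C_B:=\mathrm{C}_A(B)$ is the subgroup of elements of $A$ fixed by every element of $B$ under the action of $K$ on $A$, and $\lambda(B)$ is the number of abelian subgroups $H\le G$ with $\pi(H)=B$ and $H\cap A=C_B$. $\mathrm{Hom}(\mathbb Z^r,G)$ is the set of pairwise commuting $r$-tuples in $G^r$. $m(G)$ is the maximum order of an abelian subgroup of $G$; $N_{\max}(G)$ is the number of abelian subgroups of order $m(G)$; $b(G)$ is the second-largest order of an abelian subgroup of $G$ if $G$ is non-abelian (the largest order $<m(G)$ of an abelian subgroup), and $b(G):=0$ if $G$ is abelian. The implied constant in $O(\cdot)$ may depend on $G$ but not on $r$. *)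

theory Defs
  imports
    "HOL-Algebra.Bij"
    "HOL-Algebra.Coset"
    "HOL-Library.FuncSet"
    "HOL-Library.Landau_Symbols"
begin

definition semidirect ::
  "('a, 'm) monoid_scheme \<Rightarrow> ('k, 'n) monoid_scheme \<Rightarrow> ('k \<Rightarrow> 'a \<Rightarrow> 'a) \<Rightarrow> ('a \<times> 'k) monoid"
  where "semidirect A K \<phi> =
    \<lparr>carrier = carrier A \<times> carrier K,
     mult = (\<lambda>(a, k) (b, l). (a \<otimes>\<^bsub>A\<^esub> \<phi> k b, k \<otimes>\<^bsub>K\<^esub> l)),
     one = (\<one>\<^bsub>A\<^esub>, \<one>\<^bsub>K\<^esub>)\<rparr>"

lemma action_facts:
  assumes A: "group A" and K: "group K" and \<phi>: "\<phi> \<in> hom K (AutoGroup A)"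
  shows action_closed: "\<And>k a. k \<in> carrier K \<Longrightarrow> a \<in> carrier A \<Longrightarrow> \<phi> k a \<in> carrier A"
    and action_mult: "\<And>k a b. k \<in> carrier K \<Longrightarrow> a \<in> carrier A \<Longrightarrow> b \<in> carrier A \<Longrightarrow>
      \<phi> k (a \<otimes>\<^bsub>A\<^esub> b) = \<phi> k a \<otimes>\<^bsub>A\<^esub> \<phi> k b"
    and action_comp: "\<And>k l a. k \<in> carrier K \<Longrightarrow> l \<in> carrier K \<Longrightarrow> a \<in> carrier A \<Longrightarrow>
      \<phi> (k \<otimes>\<^bsub>K\<^esub> l) a = \<phi> k (\<phi> l a)"
    and action_one: "\<And>a. a \<in> carrier A \<Longrightarrow> \<phi> \<one>\<^bsub>K\<^esub> a = a"
proof -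
  have auto_mem: "\<phi> k \<in> hom A A" "\<phi> k \<in> Bij (carrier A)" if "k \<in> carrier K" for k
    using hom_in_carrier[OF \<phi> that] by (simp_all add: AutoGroup_def auto_def)
  show "\<phi> k a \<in> carrier A" if "k \<in> carrier K" "a \<in> carrier A" for k a
    using hom_in_carrier[OF auto_mem(1)] that by blast
  show "\<phi> k (a \<otimes>\<^bsub>A\<^esub> b) = \<phi> k a \<otimes>\<^bsub>A\<^esub> \<phi> k b"
    if "k \<in> carrier K" "a \<in> carrier A" "b \<in> carrier A" for k a b
    using hom_mult[OF auto_mem(1)] that by blast
  show "\<phi> (k \<otimes>\<^bsub>K\<^esub> l) a = \<phi> k (\<phi> l a)"
    if "k \<in> carrier K" "l \<in> carrier K" "a \<in> carrier A" for k l a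
    using hom_mult[OF \<phi> that(1,2)] auto_mem that
    by (simp add: AutoGroup_def BijGroup_def compose_def)
  have "\<phi> \<one>\<^bsub>K\<^esub> = \<one>\<^bsub>AutoGroup A\<^esub>"
    using hom_one[OF \<phi> K group.AutoGroup[OF A]] .
  then show "\<phi> \<one>\<^bsub>K\<^esub> a = a" if "a \<in> carrier A" for a
    using that by (simp add: AutoGroup_def BijGroup_def)
qed

lemma group_semidirect:
  assumes A: "group A" and K: "group K" and \<phi>: "\<phi> \<in> hom K (AutoGroup A)"
  shows "group (semidirect A K \<phi>)"
proof -
  interpret A: group A by (fact A)
  interpret K: group K by (fact K)
  note act = action_facts[OF A K \<phi>]
  show ?thesis
  proof (rule groupI, goal_cases)
    case (1 x y) then show ?case by (auto simp: semidirect_def act)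
  next
    case 2 show ?case by (simp add: semidirect_def)
  next
    case (3 x y z) then show ?case
      by (auto simp: semidirect_def act A.m_assoc K.m_assoc)
  next
    case (4 x) then show ?case by (auto simp: semidirect_def act)
  next
    case (5 x)
    obtain a k where x: "x = (a, k)" "a \<in> carrier A" "k \<in> carrier K"
      using 5 by (auto simp: semidirect_def)
    let ?y = "(\<phi> (inv\<^bsub>K\<^esub> k) (inv\<^bsub>A\<^esub> a), inv\<^bsub>K\<^esub> k)"
    have "\<phi> (inv\<^bsub>K\<^esub> k) \<one>\<^bsub>A\<^esub> = \<one>\<^bsub>A\<^esub>"
      using act(1)[of "inv\<^bsub>K\<^esub> k" "\<one>\<^bsub>A\<^esub>"] act(2)[of "inv\<^bsub>K\<^esub> k" "\<one>\<^bsub>A\<^esub>" "\<one>\<^bsub>A\<^esub>"] x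
      by (metis A.l_cancel_one' A.one_closed A.r_one K.inv_closed)
    then have "\<phi> (inv\<^bsub>K\<^esub> k) (inv\<^bsub>A\<^esub> a) \<otimes>\<^bsub>A\<^esub> \<phi> (inv\<^bsub>K\<^esub> k) a = \<one>\<^bsub>A\<^esub>"
      using x act(2)[of "inv\<^bsub>K\<^esub> k" "inv\<^bsub>A\<^esub> a" a] by simp
    then have "?y \<in> carrier (semidirect A K \<phi>)"
      "?y \<otimes>\<^bsub>semidirect A K \<phi>\<^esub> x = \<one>\<^bsub>semidirect A K \<phi>\<^esub>"
      using x by (simp_all add: semidirect_def act)
    then show ?case by blast
  qed
qed

definition fixed_by :: "('a, 'm) monoid_scheme \<Rightarrow> ('k \<Rightarrow> 'a \<Rightarrow> 'a) \<Rightarrow> 'k set \<Rightarrow> 'a set"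
  where "fixed_by A \<phi> B = {a \<in> carrier A. \<forall>k\<in>B. \<phi> k a = a}"

definition abelian_subgroups :: "('g, 'm) monoid_scheme \<Rightarrow> 'g set set"
  where "abelian_subgroups G = {H. subgroup H G \<and> comm_group (G\<lparr>carrier := H\<rparr>)}"

text \<open>
  The projection of the semidirect product onto \<open>K\<close> is \<^term>\<open>snd\<close>, and \<open>A\<close> and its
  subgroups are embedded by \<open>a \<mapsto> (a, \<one>)\<close>.
\<close>

definition num_lifts ::
  "('a, 'm) monoid_scheme \<Rightarrow> ('k, 'n) monoid_scheme \<Rightarrow> ('k \<Rightarrow> 'a \<Rightarrow> 'a) \<Rightarrow> 'k set \<Rightarrow> nat"
  where "num_lifts A K \<phi> B =
    card {H \<in> abelian_subgroups (semidirect A K \<phi>).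
      snd ` H = B \<and>
      H \<inter> (\<lambda>a. (a, \<one>\<^bsub>K\<^esub>)) ` carrier A = (\<lambda>a. (a, \<one>\<^bsub>K\<^esub>)) ` fixed_by A \<phi> B}"

definition commuting_tuples :: "nat \<Rightarrow> ('g, 'm) monoid_scheme \<Rightarrow> (nat \<Rightarrow> 'g) set"
  where "commuting_tuples r G =
    {x \<in> {..<r} \<rightarrow>\<^sub>E carrier G. \<forall>i<r. \<forall>j<r. x i \<otimes>\<^bsub>G\<^esub> x j = x j \<otimes>\<^bsub>G\<^esub> x i}"

definition max_abelian_order :: "('g, 'm) monoid_scheme \<Rightarrow> nat"
  where "max_abelian_order G = Max (card ` abelian_subgroups G)"

definition num_max_abelian :: "('g, 'm) monoid_scheme \<Rightarrow> nat"
  where "num_max_abelian G = card {H \<in> abelian_subgroups G. card H = max_abelian_order G}"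

definition second_abelian_order :: "('g, 'm) monoid_scheme \<Rightarrow> nat"
  where "second_abelian_order G =
    (if comm_group G then 0
     else Max {n \<in> card ` abelian_subgroups G. n < max_abelian_order G})"

end

theory Submission
  imports Defs "HOL-Algebra.Generated_Groups"
begin

text \<open>
  A tuple commutes iff its entries generate an abelian subgroup, so the commuting
  \<open>r\<close>-tuples are the union of the powers \<open>H\<^sup>r\<close> over the abelian subgroups \<open>H\<close>. The subgroups of order
  \<open>m(G)\<close> contribute the main term, and two distinct ones meet in an abelian subgroup of smaller
  order, so all corrections are bounded by multiples of \<open>b(G)\<^sup>r\<close>.

  For an abelian subgroup \<open>H\<close> of the semidirect product with image \<open>B\<close>, commutativity of \<open>A\<close> makes
  conjugation by \<open>(b, k)\<close> act on \<open>A\<close> as \<open>k\<close> does, so \<open>H \<inter> A \<subseteq> C\<^sub>B\<close> and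
  \<open>|H| = |H \<inter> A| |B| \<le> |C\<^sub>B| |B|\<close>, with equality iff \<open>H \<inter> A = C\<^sub>B\<close>.
  The bound is attained by the abelian subgroup \<open>C\<^sub>B \<times> B\<close>.
\<close>

section \<open>Counting commuting tuples in a finite group\<close>

lemma (in group) abelian_subgroups_iff:
  "H \<in> abelian_subgroups G \<longleftrightarrow> subgroup H G \<and> (\<forall>x\<in>H. \<forall>y\<in>H. x \<otimes> y = y \<otimes> x)"
proof
  assume "H \<in> abelian_subgroups G"
  then have H: "subgroup H G" and C: "comm_group (G\<lparr>carrier := H\<rparr>)"
    by (auto simp: abelian_subgroups_def)
  interpret C: comm_group "G\<lparr>carrier := H\<rparr>" by (fact C)
  show "subgroup H G \<and> (\<forall>x\<in>H. \<forall>y\<in>H. x \<otimes> y = y \<otimes> x)"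
    using H C.m_comm by simp
next
  assume *: "subgroup H G \<and> (\<forall>x\<in>H. \<forall>y\<in>H. x \<otimes> y = y \<otimes> x)"
  then have "comm_group (G\<lparr>carrier := H\<rparr>)"
    using group.group_comm_groupI[OF subgroup_imp_group[of H]] by simp
  with * show "H \<in> abelian_subgroups G"
    by (simp add: abelian_subgroups_def)
qed

text \<open>Stated for arbitrary subsets because it is applied both to a generating set and to the
  subgroup generated by it.\<close>

lemma (in group) subgroup_centralizer:
  assumes "S \<subseteq> carrier G"
  shows "subgroup {g \<in> carrier G. \<forall>s\<in>S. g \<otimes> s = s \<otimes> g} G"
proof (rule subgroupI)
  show "{g \<in> carrier G. \<forall>s\<in>S. g \<otimes> s = s \<otimes> g} \<noteq> {}"
    using assms by (force intro: exI[of _ \<one>])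
next
  fix a assume "a \<in> {g \<in> carrier G. \<forall>s\<in>S. g \<otimes> s = s \<otimes> g}"
  then have a: "a \<in> carrier G" and comm: "\<And>s. s \<in> S \<Longrightarrow> a \<otimes> s = s \<otimes> a" by auto
  have "inv a \<otimes> s = s \<otimes> inv a" if "s \<in> S" for s
  proof -
    have s: "s \<in> carrier G" using that assms by blast
    have "inv a \<otimes> s = inv a \<otimes> (s \<otimes> a) \<otimes> inv a"
      using a s by (simp add: m_assoc)
    also have "\<dots> = s \<otimes> inv a"
      using a s by (simp add: comm[OF that, symmetric] m_assoc[symmetric])
    finally show ?thesis .
  qed
  then show "inv a \<in> {g \<in> carrier G. \<forall>s\<in>S. g \<otimes> s = s \<otimes> g}"
    using a by simp
next
  fix a b
  assume "a \<in> {g \<in> carrier G. \<forall>s\<in>S. g \<otimes> s = s \<otimes> g}"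
    and "b \<in> {g \<in> carrier G. \<forall>s\<in>S. g \<otimes> s = s \<otimes> g}"
  then have ab: "a \<in> carrier G" "b \<in> carrier G"
    and comm: "\<And>s. s \<in> S \<Longrightarrow> a \<otimes> s = s \<otimes> a" "\<And>s. s \<in> S \<Longrightarrow> b \<otimes> s = s \<otimes> b" by auto
  have "a \<otimes> b \<otimes> s = s \<otimes> (a \<otimes> b)" if "s \<in> S" for s
  proof -
    have s: "s \<in> carrier G" using that assms by blast
    have "a \<otimes> b \<otimes> s = a \<otimes> s \<otimes> b"
      using ab s by (simp add: m_assoc comm(2)[OF that])
    also have "\<dots> = s \<otimes> (a \<otimes> b)"
      using ab s by (simp add: m_assoc comm(1)[OF that])
    finally show ?thesis .
  qed
  then show "a \<otimes> b \<in> {g \<in> carrier G. \<forall>s\<in>S. g \<otimes> s = s \<otimes> g}"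
    using ab by simp
qed auto

text \<open>Passing to centralizers twice replaces an induction over words. A commuting
  \<open>S\<close> lies in its own centralizer, hence so does \<open>generate G S\<close>. By
  symmetry \<open>S\<close> centralizes \<open>generate G S\<close>, hence
  \<open>generate G S\<close> centralizes itself.\<close>

lemma (in group) generate_commuting:
  assumes S: "S \<subseteq> carrier G" and comm: "\<And>x y. x \<in> S \<Longrightarrow> y \<in> S \<Longrightarrow> x \<otimes> y = y \<otimes> x"
  shows "generate G S \<in> abelian_subgroups G"
proof -
  let ?C = "\<lambda>T. {g \<in> carrier G. \<forall>s\<in>T. g \<otimes> s = s \<otimes> g}"
  have "generate G S \<subseteq> ?C S"
    using S comm by (intro generate_subgroup_incl subgroup_centralizer) auto
  then have "S \<subseteq> ?C (generate G S)"
    using S by auto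
  then have "generate G S \<subseteq> ?C (generate G S)"
    by (intro generate_subgroup_incl subgroup_centralizer generate_incl S)
  then show ?thesis
    using generate_is_subgroup[OF S] by (auto simp: abelian_subgroups_iff)
qed

lemma (in group) commuting_tuples_eq_UN:
  "commuting_tuples r G = (\<Union>H\<in>abelian_subgroups G. {..<r} \<rightarrow>\<^sub>E H)"
proof (intro equalityI subsetI)
  fix x assume x: "x \<in> commuting_tuples r G"
  then have "x ` {..<r} \<subseteq> carrier G" and "x \<in> extensional {..<r}"
    by (auto simp: commuting_tuples_def PiE_iff)
  moreover have "generate G (x ` {..<r}) \<in> abelian_subgroups G"
    using x by (intro generate_commuting) (auto simp: commuting_tuples_def)
  ultimately show "x \<in> (\<Union>H\<in>abelian_subgroups G. {..<r} \<rightarrow>\<^sub>E H)"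
    \<comment> \<open>For \<open>r = 0\<close> the witness is the trivial subgroup, generated by the
      empty set.\<close>
    by (intro UN_I[of "generate G (x ` {..<r})"]) (auto simp: PiE_iff intro: generate.incl)
next
  fix x assume "x \<in> (\<Union>H\<in>abelian_subgroups G. {..<r} \<rightarrow>\<^sub>E H)"
  then obtain H where "H \<in> abelian_subgroups G" and "x \<in> {..<r} \<rightarrow>\<^sub>E H" by blast
  then show "x \<in> commuting_tuples r G"
    by (auto simp: commuting_tuples_def PiE_iff abelian_subgroups_iff dest: subgroup.mem_carrier)
qed

section \<open>Orders of abelian subgroups and the asymptotic count\<close>

lemma (in group) abelian_subgroups_subset: "abelian_subgroups G \<subseteq> Pow (carrier G)"
  by (auto simp: abelian_subgroups_def dest: subgroup.subset)

lemma (in group) finite_abelian_subgroups: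
  "finite (carrier G) \<Longrightarrow> finite (abelian_subgroups G)"
  using abelian_subgroups_subset by (rule finite_subset) simp

lemma (in group) finite_abelian_subgroup:
  "finite (carrier G) \<Longrightarrow> H \<in> abelian_subgroups G \<Longrightarrow> finite H"
  using abelian_subgroups_subset by (blast intro: finite_subset)

lemma (in group) card_le_max_abelian_order:
  "finite (carrier G) \<Longrightarrow> H \<in> abelian_subgroups G \<Longrightarrow> card H \<le> max_abelian_order G"
  unfolding max_abelian_order_def by (simp add: finite_abelian_subgroups)

text \<open>Commutative groups are excluded because the second order is 0 there by convention,
  although proper subgroups have positive order.\<close>

lemma (in group) card_le_second_abelian_order:
  assumes "finite (carrier G)" and "\<not> comm_group G"
    and "H \<in> abelian_subgroups G" and "card H < max_abelian_order G"
  shows "card H \<le> second_abelian_order G"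
  using assms by (simp add: second_abelian_order_def finite_abelian_subgroups)

text \<open>A crude Bonferroni inequality. Removing from each \<open>F i\<close> its overlaps with
  the other sets costs at most \<open>card I * c\<close> elements and leaves pairwise disjoint sets
  inside the union.\<close>

lemma card_UN_ge_sum_minus_overlaps:
  fixes F :: "'i \<Rightarrow> 'b set"
  assumes "finite I" and fin: "\<And>i. i \<in> I \<Longrightarrow> finite (F i)"
    and overlap: "\<And>i j. i \<in> I \<Longrightarrow> j \<in> I \<Longrightarrow> i \<noteq> j \<Longrightarrow> card (F i \<inter> F j) \<le> c"
  shows "(\<Sum>i\<in>I. card (F i)) \<le> card (\<Union>i\<in>I. F i) + card I * (card I * c)"
proof -
  define D where "D i = F i - (\<Union>j\<in>I - {i}. F i \<inter> F j)" for i
  have "card (F i) \<le> card (D i) + card I * c" if i: "i \<in> I" for i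
  proof -
    have "card (F i) \<le> card (D i \<union> (\<Union>j\<in>I - {i}. F i \<inter> F j))"
      using fin i assms(1) by (intro card_mono) (auto simp: D_def)
    also have "\<dots> \<le> card (D i) + card (\<Union>j\<in>I - {i}. F i \<inter> F j)"
      by (rule card_Un_le)
    also have "card (\<Union>j\<in>I - {i}. F i \<inter> F j) \<le> (\<Sum>j\<in>I - {i}. card (F i \<inter> F j))"
      using assms(1) by (intro card_UN_le) simp
    also have "\<dots> \<le> card (I - {i}) * c"
      using sum_bounded_above[of "I - {i}" "\<lambda>j. card (F i \<inter> F j)" c] overlap i by auto
    also have "\<dots> \<le> card I * c"
      using assms(1) by (intro mult_right_mono card_mono) auto
    finally show ?thesis by simp
  qed
  then have "(\<Sum>i\<in>I. card (F i)) \<le> (\<Sum>i\<in>I. card (D i) + card I * c)"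
    by (rule sum_mono)
  also have "\<dots> = (\<Sum>i\<in>I. card (D i)) + card I * (card I * c)"
    by (simp add: sum.distrib)
  also have "(\<Sum>i\<in>I. card (D i)) = card (\<Union>i\<in>I. D i)"
    using assms(1) fin by (subst card_UN_disjoint) (auto simp: D_def)
  also have "\<dots> \<le> card (\<Union>i\<in>I. F i)"
    using assms(1) fin by (intro card_mono) (auto simp: D_def)
  finally show ?thesis by simp
qed

text \<open>The upper bound is the union bound over all abelian subgroups, split by whether the
  order is maximal. The lower bound keeps only those of maximal order and controls their
  overlaps.\<close>

lemma (in group) commuting_tuples_asymptotics_nonabelian:
  assumes fin: "finite (carrier G)" and nonab: "\<not> comm_group G"
  shows "(\<lambda>r. real (card (commuting_tuples r G)) -
      real (num_max_abelian G) * real (max_abelian_order G) ^ r)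
    \<in> O(\<lambda>r. real (second_abelian_order G) ^ r)"
proof -
  let ?S = "abelian_subgroups G" and ?m = "max_abelian_order G" and ?b = "second_abelian_order G"
  define M where "M = {H \<in> ?S. card H = ?m}"
  have finS: "finite ?S" by (rule finite_abelian_subgroups[OF fin])
  have finM: "finite M" and MS: "M \<subseteq> ?S" using finS by (auto simp: M_def)
  have finH: "finite H" if "H \<in> ?S" for H using finite_abelian_subgroup[OF fin that] .
  have small: "card H \<le> ?b" if "H \<in> ?S - M" for H
    using card_le_second_abelian_order[OF fin nonab, of H] card_le_max_abelian_order[OF fin, of H] that
    by (auto simp: M_def)
  have cardM: "(\<Sum>H\<in>M. card ({..<r} \<rightarrow>\<^sub>E H)) = num_max_abelian G * ?m ^ r" for r
    by (simp add: M_def num_max_abelian_def card_PiE)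
  have upper: "card (commuting_tuples r G) \<le> num_max_abelian G * ?m ^ r + card ?S * ?b ^ r" for r
  proof -
    have "card (commuting_tuples r G) \<le> (\<Sum>H\<in>?S. card ({..<r} \<rightarrow>\<^sub>E H))"
      unfolding commuting_tuples_eq_UN by (rule card_UN_le[OF finS])
    also have "\<dots> = num_max_abelian G * ?m ^ r + (\<Sum>H\<in>?S - M. card ({..<r} \<rightarrow>\<^sub>E H))"
      using sum.subset_diff[OF MS finS, of "\<lambda>H. card ({..<r} \<rightarrow>\<^sub>E H)"] cardM[of r] by simp
    also have "(\<Sum>H\<in>?S - M. card ({..<r} \<rightarrow>\<^sub>E H)) \<le> card (?S - M) * ?b ^ r"
      using sum_bounded_above[of "?S - M" "\<lambda>H. card ({..<r} \<rightarrow>\<^sub>E H)" "?b ^ r"] small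
      by (simp add: card_PiE power_mono)
    also have "\<dots> \<le> card ?S * ?b ^ r"
      using finS by (intro mult_right_mono card_mono) auto
    finally show ?thesis by simp
  qed
  have lower: "num_max_abelian G * ?m ^ r \<le> card (commuting_tuples r G) + card M * (card M * ?b ^ r)"
    for r
  proof -
    have "card (({..<r} \<rightarrow>\<^sub>E H) \<inter> ({..<r} \<rightarrow>\<^sub>E J)) \<le> ?b ^ r"
      if "H \<in> M" "J \<in> M" "H \<noteq> J" for H J
    proof -
      have HJ: "H \<in> ?S" "J \<in> ?S" and eq: "card H = ?m" "card J = ?m"
        using that by (auto simp: M_def)
      have I: "H \<inter> J \<in> ?S"
        using HJ by (auto simp: abelian_subgroups_iff intro: subgroups_Inter_pair)
      \<comment> \<open>Otherwise \<open>H\<close> is contained in \<open>J\<close>, and equal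
        finite orders force \<open>H = J\<close>.\<close>
      have "H \<inter> J \<noteq> H"
        using card_subset_eq[OF finH[OF HJ(2)], of H] eq that(3) by auto
      then have "card (H \<inter> J) < ?m"
        using psubset_card_mono[OF finH[OF HJ(1)], of "H \<inter> J"] eq by auto
      then have "card (H \<inter> J) \<le> ?b"
        by (intro card_le_second_abelian_order fin nonab I)
      then show ?thesis
        by (simp add: PiE_Int card_PiE power_mono)
    qed
    then have "num_max_abelian G * ?m ^ r
        \<le> card (\<Union>H\<in>M. {..<r} \<rightarrow>\<^sub>E H) + card M * (card M * ?b ^ r)"
      unfolding cardM[symmetric] using MS finH
      by (intro card_UN_ge_sum_minus_overlaps finM finite_PiE) auto
    moreover have "card (\<Union>H\<in>M. {..<r} \<rightarrow>\<^sub>E H) \<le> card (commuting_tuples r G)"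
      unfolding commuting_tuples_eq_UN using MS finS finH
      by (intro card_mono finite_UN_I finite_PiE) auto
    ultimately show ?thesis by simp
  qed
  \<comment> \<open>The first summand comes from \<open>upper\<close>, the second from
    \<open>lower\<close>; neither depends on \<open>r\<close>.\<close>
  let ?c = "real (card ?S + card M * card M)"
  have "\<bar>real (card (commuting_tuples r G)) - real (num_max_abelian G) * real ?m ^ r\<bar>
      \<le> ?c * real ?b ^ r" for r
  proof -
    have "real (card (commuting_tuples r G))
        \<le> real (num_max_abelian G) * real ?m ^ r + real (card ?S) * real ?b ^ r"
      using of_nat_mono[OF upper[of r], where ?'a = real] by simp
    moreover have "real (num_max_abelian G) * real ?m ^ r
        \<le> real (card (commuting_tuples r G)) + real (card M) * (real (card M) * real ?b ^ r)"
      using of_nat_mono[OF lower[of r], where ?'a = real] by simp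
    moreover have "0 \<le> real (card ?S) * real ?b ^ r"
      "0 \<le> real (card M) * (real (card M) * real ?b ^ r)"
      by simp_all
    ultimately show ?thesis
      unfolding of_nat_add of_nat_mult distrib_right mult.assoc by linarith
  qed
  then show ?thesis
    by (intro bigoI[of _ ?c] always_eventually allI) simp
qed

lemma (in comm_group) max_abelian_comm_group:
  assumes "finite (carrier G)"
  shows "max_abelian_order G = order G" and "num_max_abelian G = 1"
proof -
  have self: "carrier G \<in> abelian_subgroups G"
    by (simp add: abelian_subgroups_iff subgroup_self m_comm)
  show m: "max_abelian_order G = order G"
    unfolding max_abelian_order_def order_def
    using self assms abelian_subgroups_subset
    by (intro Max_eqI) (auto simp: finite_abelian_subgroups intro!: card_mono)
  have "{H \<in> abelian_subgroups G. card H = order G} = {carrier G}"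
    using self assms abelian_subgroups_subset by (auto simp: order_def dest: card_subset_eq)
  then show "num_max_abelian G = 1"
    by (simp add: num_max_abelian_def m)
qed

lemma (in comm_group) card_commuting_tuples:
  "card (commuting_tuples r G) = order G ^ r"
proof -
  have "commuting_tuples r G = {..<r} \<rightarrow>\<^sub>E carrier G"
    unfolding commuting_tuples_def using m_comm by (blast dest: PiE_mem)
  then show ?thesis by (simp add: card_PiE order_def)
qed

theorem (in group) commuting_tuples_asymptotics:
  assumes fin: "finite (carrier G)"
  shows "(\<lambda>r. real (card (commuting_tuples r G)) -
      real (num_max_abelian G) * real (max_abelian_order G) ^ r)
    \<in> O(\<lambda>r. real (second_abelian_order G) ^ r)"
proof (cases "comm_group G")
  case True
  \<comment> \<open>The difference vanishes identically, as it must for \<open>r > 0\<close>, where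
    the bound is a positive power of 0.\<close>
  then show ?thesis
    by (simp add: comm_group.card_commuting_tuples comm_group.max_abelian_comm_group[OF True fin])
next
  case False
  then show ?thesis
    by (rule commuting_tuples_asymptotics_nonabelian[OF fin])
qed

section \<open>Abelian subgroups of a semidirect product\<close>

locale abelian_semidirect = A: comm_group A + K: comm_group K
  for A :: "('a, 'm) monoid_scheme" and K :: "('k, 'n) monoid_scheme" +
  fixes \<phi> :: "'k \<Rightarrow> 'a \<Rightarrow> 'a"
  assumes finite_A: "finite (carrier A)" and finite_K: "finite (carrier K)"
    and action: "\<phi> \<in> hom K (AutoGroup A)"
begin

abbreviation G :: "('a \<times> 'k) monoid" where "G \<equiv> semidirect A K \<phi>"

abbreviation emb :: "'a \<Rightarrow> 'a \<times> 'k" where "emb a \<equiv> (a, \<one>\<^bsub>K\<^esub>)"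

sublocale G: group G
  using A.group_axioms K.group_axioms action by (rule group_semidirect)

lemmas act = action_facts[OF A.group_axioms K.group_axioms action]

lemma carrier_G: "carrier G = carrier A \<times> carrier K"
  and mult_G: "(a, k) \<otimes>\<^bsub>G\<^esub> (b, l) = (a \<otimes>\<^bsub>A\<^esub> \<phi> k b, k \<otimes>\<^bsub>K\<^esub> l)"
  by (simp_all add: semidirect_def)

lemma finite_G: "finite (carrier G)"
  by (simp add: carrier_G finite_A finite_K)

lemma inj_emb: "inj_on emb S"
  by (simp add: inj_on_def)

lemma group_hom_snd: "group_hom G K snd"
  by unfold_locales (auto simp: hom_def semidirect_def)

lemma subgroup_snd: "subgroup H G \<Longrightarrow> subgroup (snd ` H) K"
  using group_hom.subgroup_img_is_subgroup[OF group_hom_snd] .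

text \<open>The nonempty fibres of the projection on \<open>H\<close> are cosets of its kernel, the
  intersection of \<open>H\<close> with the embedded copy of \<open>A\<close>, so all have the same
  size.\<close>

lemma card_subgroup:
  assumes H: "subgroup H G"
  shows "card H = card (H \<inter> emb ` carrier A) * card (snd ` H)"
proof -
  have sub: "H \<subseteq> carrier G" using H by (rule subgroup.subset)
  have finH: "finite H" using finite_subset[OF sub finite_G] .
  have fibre: "card {h \<in> H. snd h = k} = card (H \<inter> emb ` carrier A)" if k: "k \<in> snd ` H" for k
  proof -
    obtain a where ak: "(a, k) \<in> H" using k by auto
    then have a: "a \<in> carrier A" "k \<in> carrier K" using sub by (auto simp: carrier_G)
    \<comment> \<open>Right translation by a chosen point of the fibre carries the kernel onto it;
      translation by the inverse of that point undoes this.\<close>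
    have "bij_betw (\<lambda>h. h \<otimes>\<^bsub>G\<^esub> (a, k)) (H \<inter> emb ` carrier A) {h \<in> H. snd h = k}"
    proof (rule bij_betw_byWitness[where f' = "\<lambda>h. h \<otimes>\<^bsub>G\<^esub> inv\<^bsub>G\<^esub> (a, k)"])
      have mem: "(a, k) \<in> carrier G" "\<And>h. h \<in> H \<Longrightarrow> h \<in> carrier G" using ak sub by auto
      show "\<forall>h\<in>H \<inter> emb ` carrier A. h \<otimes>\<^bsub>G\<^esub> (a, k) \<otimes>\<^bsub>G\<^esub> inv\<^bsub>G\<^esub> (a, k) = h"
        using mem by (simp add: G.m_assoc)
      show "\<forall>h\<in>{h \<in> H. snd h = k}. h \<otimes>\<^bsub>G\<^esub> inv\<^bsub>G\<^esub> (a, k) \<otimes>\<^bsub>G\<^esub> (a, k) = h"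
        using mem by (simp add: G.m_assoc)
      show "(\<lambda>h. h \<otimes>\<^bsub>G\<^esub> (a, k)) ` (H \<inter> emb ` carrier A) \<subseteq> {h \<in> H. snd h = k}"
      proof (rule image_subsetI)
        fix h assume "h \<in> H \<inter> emb ` carrier A"
        then have "h \<in> H" and "snd (h \<otimes>\<^bsub>G\<^esub> (a, k)) = k"
          using a by (auto simp: mult_G)
        then show "h \<otimes>\<^bsub>G\<^esub> (a, k) \<in> {h \<in> H. snd h = k}"
          using subgroup.m_closed[OF H _ ak] by simp
      qed
      show "(\<lambda>h. h \<otimes>\<^bsub>G\<^esub> inv\<^bsub>G\<^esub> (a, k)) ` {h \<in> H. snd h = k} \<subseteq> H \<inter> emb ` carrier A"
      proof (rule image_subsetI)
        fix h assume "h \<in> {h \<in> H. snd h = k}"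
        then have h: "h \<in> H" "snd h = k" by auto
        let ?g = "h \<otimes>\<^bsub>G\<^esub> inv\<^bsub>G\<^esub> (a, k)"
        have g: "?g \<in> H"
          using h ak by (simp add: subgroup.m_closed[OF H] subgroup.m_inv_closed[OF H])
        have "snd ?g = \<one>\<^bsub>K\<^esub>"
          using h mem a hom_mult[OF group_hom.homh[OF group_hom_snd], of h "inv\<^bsub>G\<^esub> (a, k)"]
            group_hom.hom_inv[OF group_hom_snd, of "(a, k)"] by simp
        moreover have "fst ?g \<in> carrier A"
          using mem(2)[OF g] by (auto simp: carrier_G)
        ultimately have "?g \<in> emb ` carrier A"
          by (intro image_eqI[of _ _ "fst ?g"]) (simp_all add: prod_eq_iff)
        with g show "?g \<in> H \<inter> emb ` carrier A" ..
      qed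
    qed
    then show ?thesis by (simp add: bij_betw_same_card)
  qed
  have "card H = (\<Sum>k\<in>snd ` H. card {h \<in> H. snd h = k})"
    using sum.image_gen[OF finH, of "\<lambda>_. 1 :: nat" snd] by simp
  then show ?thesis
    using fibre by simp
qed

lemma abelian_Int_A_subset:
  assumes H: "H \<in> abelian_subgroups G"
  shows "H \<inter> emb ` carrier A \<subseteq> emb ` fixed_by A \<phi> (snd ` H)"
proof clarify
  fix a assume a: "a \<in> carrier A" and aH: "emb a \<in> H"
  have "\<phi> k a = a" if "(b, k) \<in> H" for b k
  proof -
    have b: "b \<in> carrier A" "k \<in> carrier K"
      using that H G.abelian_subgroups_subset by (auto simp: carrier_G)
    have "(b, k) \<otimes>\<^bsub>G\<^esub> emb a = emb a \<otimes>\<^bsub>G\<^esub> (b, k)"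
      using H that aH by (simp add: G.abelian_subgroups_iff)
    \<comment> \<open>Only first components matter: on the right \<open>\<one>\<close> acts
      trivially, and commutativity of \<open>A\<close> brings \<open>b\<close> to the front for
      cancellation.\<close>
    then have "b \<otimes>\<^bsub>A\<^esub> \<phi> k a = b \<otimes>\<^bsub>A\<^esub> a"
      using a b by (simp add: mult_G act A.m_comm)
    then show ?thesis using a b by (simp add: act)
  qed
  then show "emb a \<in> emb ` fixed_by A \<phi> (snd ` H)"
    using a by (auto simp: fixed_by_def)
qed

text \<open>Elements of \<open>B\<close> act trivially on their fixed points, so the twist
  disappears and multiplication is componentwise. This subgroup shows that the upper bound on orders
  is attained.\<close>

lemma fixed_Times_abelian:
  assumes B: "subgroup B K"
  shows "fixed_by A \<phi> B \<times> B \<in> abelian_subgroups G"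
proof -
  have one: "\<phi> k \<one>\<^bsub>A\<^esub> = \<one>\<^bsub>A\<^esub>" if "k \<in> carrier K" for k
    using act(1)[OF that A.one_closed] act(2)[OF that A.one_closed A.one_closed]
    by (metis A.l_cancel_one' A.one_closed A.r_one)
  have BK: "k \<in> B \<Longrightarrow> k \<in> carrier K" for k using subgroup.subset[OF B] by blast
  have mult: "(a, k) \<otimes>\<^bsub>G\<^esub> (b, l) = (a \<otimes>\<^bsub>A\<^esub> b, k \<otimes>\<^bsub>K\<^esub> l)"
    if "b \<in> fixed_by A \<phi> B" "k \<in> B" for a k b l
    using that by (simp add: mult_G fixed_by_def)
  have inv_fixed: "inv\<^bsub>A\<^esub> a \<in> fixed_by A \<phi> B" if "a \<in> fixed_by A \<phi> B" for a
  proof -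
    have a: "a \<in> carrier A" "\<And>k. k \<in> B \<Longrightarrow> \<phi> k a = a" using that by (auto simp: fixed_by_def)
    have "\<phi> k (inv\<^bsub>A\<^esub> a) = inv\<^bsub>A\<^esub> a" if "k \<in> B" for k
    proof -
      have "\<phi> k (inv\<^bsub>A\<^esub> a) \<otimes>\<^bsub>A\<^esub> a = \<one>\<^bsub>A\<^esub>"
        using act(2)[OF BK[OF that], of "inv\<^bsub>A\<^esub> a" a] a that by (simp add: one BK)
      then show ?thesis
        using a that by (metis A.inv_equality A.inv_closed act(1) BK)
    qed
    then show ?thesis using a by (simp add: fixed_by_def)
  qed
  have "subgroup (fixed_by A \<phi> B \<times> B) G"
  proof (rule G.subgroupI)
    show "fixed_by A \<phi> B \<times> B \<subseteq> carrier G"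
      using BK by (auto simp: carrier_G fixed_by_def)
    show "fixed_by A \<phi> B \<times> B \<noteq> {}"
      using subgroup.one_closed[OF B] one BK by (auto simp: fixed_by_def)
  next
    fix x assume "x \<in> fixed_by A \<phi> B \<times> B"
    then obtain a k where x: "x = (a, k)" "a \<in> fixed_by A \<phi> B" "k \<in> B" by auto
    have aA: "a \<in> carrier A" "inv\<^bsub>A\<^esub> a \<in> fixed_by A \<phi> B" "inv\<^bsub>K\<^esub> k \<in> B"
      using x inv_fixed subgroup.m_inv_closed[OF B] by (auto simp: fixed_by_def)
    then have "(inv\<^bsub>A\<^esub> a, inv\<^bsub>K\<^esub> k) \<otimes>\<^bsub>G\<^esub> x = \<one>\<^bsub>G\<^esub>"
      \<comment> \<open>The product is computed by \<open>mult\<close> while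
        \<open>semidirect\<close> is still folded; only then is the unit unfolded.\<close>
      using x BK by (simp add: mult) (simp add: semidirect_def)
    then have "inv\<^bsub>G\<^esub> x = (inv\<^bsub>A\<^esub> a, inv\<^bsub>K\<^esub> k)"
      using x aA BK by (intro G.inv_equality) (auto simp: carrier_G)
    then show "inv\<^bsub>G\<^esub> x \<in> fixed_by A \<phi> B \<times> B" using aA by simp
  next
    fix x y assume "x \<in> fixed_by A \<phi> B \<times> B" "y \<in> fixed_by A \<phi> B \<times> B"
    then show "x \<otimes>\<^bsub>G\<^esub> y \<in> fixed_by A \<phi> B \<times> B"
      by (auto simp: mult subgroup.m_closed[OF B]) (auto simp: fixed_by_def act BK)
  qed
  moreover have "x \<otimes>\<^bsub>G\<^esub> y = y \<otimes>\<^bsub>G\<^esub> x"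
    if "x \<in> fixed_by A \<phi> B \<times> B" "y \<in> fixed_by A \<phi> B \<times> B" for x y
    using that by (auto simp: mult) (auto simp: fixed_by_def BK intro: A.m_comm K.m_comm)
  ultimately show ?thesis by (simp add: G.abelian_subgroups_iff)
qed

section \<open>Maximal order and the count of maximal abelian subgroups by their image\<close>

lemma finite_fixed_by: "finite (fixed_by A \<phi> B)"
  using finite_A by (simp add: fixed_by_def)

lemma finite_subgroups_K: "finite {B. subgroup B K}"
  by (rule finite_subset[of _ "Pow (carrier K)"]) (auto simp: finite_K dest: subgroup.subset)

lemma card_abelian_le:
  assumes H: "H \<in> abelian_subgroups G"
  shows "card H \<le> card (fixed_by A \<phi> (snd ` H)) * card (snd ` H)"
proof -
  have "card (H \<inter> emb ` carrier A) \<le> card (emb ` fixed_by A \<phi> (snd ` H))"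
    using abelian_Int_A_subset[OF H] by (intro card_mono) (simp_all add: finite_fixed_by)
  then show ?thesis
    using H card_subgroup[of H] by (simp add: card_image[OF inj_emb] G.abelian_subgroups_iff)
qed

lemma fixed_mult_card_le_max:
  "subgroup B K \<Longrightarrow> card (fixed_by A \<phi> B) * card B \<le> max_abelian_order G"
  using G.card_le_max_abelian_order[OF finite_G fixed_Times_abelian] by (simp add: card_cartesian_product)

lemma max_abelian_order_eq:
  "max_abelian_order G = Max {card (fixed_by A \<phi> B) * card B | B. subgroup B K}"
proof (rule Max_eqI[symmetric])
  show "finite {card (fixed_by A \<phi> B) * card B | B. subgroup B K}"
    using finite_subgroups_K by simp
  show "y \<le> max_abelian_order G" if "y \<in> {card (fixed_by A \<phi> B) * card B | B. subgroup B K}" for y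
    using that fixed_mult_card_le_max by auto
  \<comment> \<open>The case \<open>B = carrier K\<close> of \<open>fixed_Times_abelian\<close>
    supplies nonemptiness, so the maximum is attained.\<close>
  have "max_abelian_order G \<in> card ` abelian_subgroups G"
    unfolding max_abelian_order_def
    using G.finite_abelian_subgroups[OF finite_G] fixed_Times_abelian[OF K.subgroup_self]
    by (intro Max_in) auto
  then obtain H where H: "H \<in> abelian_subgroups G" "max_abelian_order G = card H" by auto
  then have B: "subgroup (snd ` H) K" by (auto simp: G.abelian_subgroups_iff intro: subgroup_snd)
  \<comment> \<open>The product for the image of \<open>H\<close> is squeezed between
    \<open>card H\<close> and the maximum, which coincide.\<close>
  then have "max_abelian_order G = card (fixed_by A \<phi> (snd ` H)) * card (snd ` H)"
    using fixed_mult_card_le_max[OF B] card_abelian_le[OF H(1)] H(2) by simp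
  with B show "max_abelian_order G \<in> {card (fixed_by A \<phi> B) * card B | B. subgroup B K}"
    by blast
qed

text \<open>A maximal \<open>H\<close> makes every inequality in the order bound an equality.
  Cancelling the positive order of the image gives equal cardinalities, which turns the inclusion of
  the intersection in the fixed points into an equality. The converse is the order formula.\<close>

lemma max_abelian_iff:
  assumes H: "H \<in> abelian_subgroups G"
  shows "card H = max_abelian_order G \<longleftrightarrow>
    card (fixed_by A \<phi> (snd ` H)) * card (snd ` H) = max_abelian_order G \<and>
    H \<inter> emb ` carrier A = emb ` fixed_by A \<phi> (snd ` H)"
proof
  have sub: "subgroup H G" using H by (simp add: G.abelian_subgroups_iff)
  note B = subgroup_snd[OF sub]
  have pos: "card (snd ` H) > 0"
    using subgroup.finite_imp_card_positive[OF B finite_K] .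
  assume max: "card H = max_abelian_order G"
  then have eq: "card (fixed_by A \<phi> (snd ` H)) * card (snd ` H) = max_abelian_order G"
    using fixed_mult_card_le_max[OF B] card_abelian_le[OF H] by simp
  then have "card (H \<inter> emb ` carrier A) = card (emb ` fixed_by A \<phi> (snd ` H))"
    using card_subgroup[OF sub] max pos by (simp add: card_image[OF inj_emb])
  then have "H \<inter> emb ` carrier A = emb ` fixed_by A \<phi> (snd ` H)"
    using abelian_Int_A_subset[OF H] by (intro card_subset_eq) (simp_all add: finite_fixed_by)
  with eq show "card (fixed_by A \<phi> (snd ` H)) * card (snd ` H) = max_abelian_order G \<and>
    H \<inter> emb ` carrier A = emb ` fixed_by A \<phi> (snd ` H)" ..
next
  assume "card (fixed_by A \<phi> (snd ` H)) * card (snd ` H) = max_abelian_order G \<and>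
    H \<inter> emb ` carrier A = emb ` fixed_by A \<phi> (snd ` H)"
  then show "card H = max_abelian_order G"
    using card_subgroup[of H] H by (simp add: card_image[OF inj_emb] G.abelian_subgroups_iff)
qed

text \<open>Subgroups of maximal order are sorted by their image in \<open>K\<close>. The classes
  are disjoint since \<open>H\<close> determines \<open>B\<close>, and
  \<open>max_abelian_iff\<close> identifies each class with the lifts of \<open>B\<close>.\<close>

lemma num_max_abelian_eq:
  "num_max_abelian G =
    (\<Sum>B | subgroup B K \<and> card (fixed_by A \<phi> B) * card B = max_abelian_order G.
      num_lifts A K \<phi> B)"
proof -
  let ?Bs = "{B. subgroup B K \<and> card (fixed_by A \<phi> B) * card B = max_abelian_order G}"
  let ?L = "\<lambda>B. {H \<in> abelian_subgroups G. snd ` H = B \<and>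
    H \<inter> emb ` carrier A = emb ` fixed_by A \<phi> B}"
  have "{H \<in> abelian_subgroups G. card H = max_abelian_order G} = (\<Union>B\<in>?Bs. ?L B)"
    using subgroup_snd by (auto simp: max_abelian_iff) (auto simp: G.abelian_subgroups_iff)
  then have "num_max_abelian G = card (\<Union>B\<in>?Bs. ?L B)"
    by (simp add: num_max_abelian_def)
  also have "\<dots> = (\<Sum>B\<in>?Bs. card (?L B))"
    using finite_subgroups_K G.finite_abelian_subgroups[OF finite_G]
    by (intro card_UN_disjoint) auto
  finally show ?thesis by (simp add: num_lifts_def)
qed

end

theorem proposition4p8:
  fixes A :: "('a, 'm) monoid_scheme"
    and K :: "('k, 'n) monoid_scheme"
    and \<phi> :: "'k \<Rightarrow> 'a \<Rightarrow> 'a"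
    and G :: "('a \<times> 'k) monoid"
  assumes "comm_group A" and "finite (carrier A)"
    and "comm_group K" and "finite (carrier K)"
    and "\<phi> \<in> hom K (AutoGroup A)"
    and "G = semidirect A K \<phi>"
  shows "max_abelian_order G = Max {card (fixed_by A \<phi> B) * card B | B. subgroup B K} \<and>
      num_max_abelian G =
      (\<Sum>B | subgroup B K \<and> card (fixed_by A \<phi> B) * card B = max_abelian_order G.
        num_lifts A K \<phi> B) \<and>
      (\<lambda>r. real (card (commuting_tuples r G)) -
        real (\<Sum>B | subgroup B K \<and> card (fixed_by A \<phi> B) * card B = max_abelian_order G.
          num_lifts A K \<phi> B) * real (max_abelian_order G) ^ r)
      \<in> O(\<lambda>r. real (second_abelian_order G) ^ r)"
proof -
  interpret abelian_semidirect A K \<phi>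
    using assms by (simp add: abelian_semidirect_def abelian_semidirect_axioms_def)
  show ?thesis
    \<comment> \<open>Folding the sum of lifts back into \<open>num_max_abelian\<close> reduces the
      estimate to the one for arbitrary finite groups.\<close>
    unfolding assms(6) num_max_abelian_eq[symmetric]
    using max_abelian_order_eq G.commuting_tuples_asymptotics[OF finite_G] by blast
qed

end
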